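(* Let $\alpha\in[0,1]$. Consider the qubit prepare-transform-measure game described in the context. For every strategy (arbitrary qubit states of Alice, arbitrary two-outcome qubit instruments of Bob, hence including those realizing unsharp measurements, arbitrary two-outcome qubit POVMs of Charlie, and arbitrary shared classical randomness) the average success probability satisfies $$\bar P_{\mathrm{succ}}\le \bar P^{\mathrm{POVM}}_{\mathrm{succ}}(\alpha)=\frac12+\frac{1-\alpha}{4\sqrt2}+\frac{1}{4\sqrt2}\sqrt{(1-\alpha)^2+4\alpha^2}.$$
   Context: Let $\mathcal H$ be a complex Hilbert space with $\dim\mathcal H=2$ and $\mathcal L(\mathcal H)$ the linear operators on it. A two-outcome POVM is an ordered pair $(B_0,B_1)$ of positive semidefinite operators in $\mathcal L(\mathcal H)$ with $B_0+B_1=\mathbb 1$. A two-outcome (qubit) instrument is an ordered pair $(\mathcal B_0,\mathcal B_1)$ of completely positive trace-nonincreasing maps $\mathcal L(\mathcal H)\to\mathcal L(\mathcal H)$ whose sum $\mathcal B_0+\mathcal B_1$ is trace preserving. The game: Alice receives $\vec x=(x_0,x_1)\in\{0,1\}^2$, Bob receives $y\in\{0,1\}$, Charlie receives $z\in\{0,1\}$; all bits are independent and uniformly distributed. Without shared randomness, a strategy consists of qubit density operators $\varrho_{\vec x}$ for $\vec x\in\{0,1\}^2$ (prepared by Alice and sent to Bob), instruments $(\mathcal B^y_0,\mathcal B^y_1)$ for $y=0,1$ (applied by Bob, who outputs $b$ and sends the resulting qubit to Charlie), and two-outcome POVMs $(C^z_0,C^z_1)$ for $z=0,1$ (measured by Charlie,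 who outputs $c$), giving $$p(b,c|\vec x,y,z)=\mathrm{tr}\big(\mathcal B^y_b(\varrho_{\vec x})\,C^z_c\big).$$ The parties share no entanglement but may share arbitrary classical randomness: a general strategy chooses such a tuple of states, instruments and POVMs according to a shared random variable independent of the inputs, and $p(b,c|\vec x,y,z)$ is the corresponding average. Put $\Pr(b|\vec x,y)=\sum_c p(b,c|\vec x,y,z)$ (independent of $z$) and $\Pr(c|\vec x,z)=\frac12\sum_{y}\sum_b p(b,c|\vec x,y,z)$. For $\alpha\in[0,1]$ the average success probability is $$\bar P_{\mathrm{succ}}=\frac{\alpha}{8}\sum_{\vec x,y}\Pr(b=x_y|\vec x,y)+\frac{1-\alpha}{8}\sum_{\vec x,z}\Pr(c=x_z|\vec x,z).$$ *)

theory Defs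
  imports "HOL-Probability.Probability"
begin

text \<open>
  Operators on the two-dimensional Hilbert space are matrices over \<open>\<complex>\<^sup>2\<close>.
\<close>

type_synonym qubit_op = "complex ^ 2 ^ 2"

definition cdot :: "complex ^ 'n \<Rightarrow> complex ^ 'n \<Rightarrow> complex" where
  "cdot u v = (\<Sum>i\<in>UNIV. cnj (u $ i) * v $ i)"

text \<open>
  Over the complex numbers, nonnegativity of the quadratic form already forces Hermiticity.
\<close>

definition pos_semidef :: "complex ^ 'n ^ 'n \<Rightarrow> bool" where
  "pos_semidef A \<longleftrightarrow> (\<forall>v. cdot v (A *v v) \<in> \<real>\<^sub>\<ge>\<^sub>0)"

definition density_op :: "complex ^ 'n ^ 'n \<Rightarrow> bool" where
  "density_op \<rho> \<longleftrightarrow> pos_semidef \<rho> \<and> trace \<rho> = 1"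

text \<open>
  The library's scaling \<open>*s\<close> on \<open>complex ^ 'n ^ 'n\<close> takes row vectors as scalars,
  so scaling by a complex number needs its own name.
\<close>

definition cscale :: "complex \<Rightarrow> complex ^ 'n ^ 'm \<Rightarrow> complex ^ 'n ^ 'm" where
  "cscale c A = map_matrix ((*) c) A"

definition linear_map :: "(complex ^ 'n ^ 'n \<Rightarrow> complex ^ 'm ^ 'm) \<Rightarrow> bool" where
  "linear_map \<Phi> \<longleftrightarrow> Vector_Spaces.linear cscale cscale \<Phi>"

text \<open>
  \<open>A i j\<close> for \<open>i, j < k\<close> is the \<open>(i, j)\<close> block of an operator on \<open>\<complex>\<^sup>k \<otimes> \<complex>\<^sup>n\<close>; a vector of that
  space is a family of \<open>k\<close> vectors of \<open>\<complex>\<^sup>n\<close>. In this picture \<open>id\<^sub>k \<otimes> \<Phi>\<close> applies \<open>\<Phi>\<close> to each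
  block.
\<close>

definition block_pos_semidef :: "nat \<Rightarrow> (nat \<Rightarrow> nat \<Rightarrow> complex ^ 'n ^ 'n) \<Rightarrow> bool" where
  "block_pos_semidef k A \<longleftrightarrow>
    (\<forall>v :: nat \<Rightarrow> complex ^ 'n. (\<Sum>i<k. \<Sum>j<k. cdot (v i) (A i j *v v j)) \<in> \<real>\<^sub>\<ge>\<^sub>0)"

definition completely_positive :: "(complex ^ 'n ^ 'n \<Rightarrow> complex ^ 'm ^ 'm) \<Rightarrow> bool" where
  "completely_positive \<Phi> \<longleftrightarrow> linear_map \<Phi> \<and>
    (\<forall>k A. block_pos_semidef k A \<longrightarrow> block_pos_semidef k (\<lambda>i j. \<Phi> (A i j)))"

definition trace_nonincreasing :: "(complex ^ 'n ^ 'n \<Rightarrow> complex ^ 'm ^ 'm) \<Rightarrow> bool" where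
  "trace_nonincreasing \<Phi> \<longleftrightarrow> (\<forall>A. pos_semidef A \<longrightarrow> Re (trace (\<Phi> A)) \<le> Re (trace A))"

definition trace_preserving :: "(complex ^ 'n ^ 'n \<Rightarrow> complex ^ 'm ^ 'm) \<Rightarrow> bool" where
  "trace_preserving \<Phi> \<longleftrightarrow> (\<forall>A. trace (\<Phi> A) = trace A)"

text \<open>
  Bits are Booleans with \<open>False\<close> for 0 and \<open>True\<close> for 1; ordered pairs indexed by an outcome bit
  are functions on \<open>bool\<close>.
\<close>

definition povm :: "(bool \<Rightarrow> complex ^ 'n ^ 'n) \<Rightarrow> bool" where
  "povm C \<longleftrightarrow> (\<forall>c. pos_semidef (C c)) \<and> C False + C True = mat 1"

definition instrument :: "(bool \<Rightarrow> complex ^ 'n ^ 'n \<Rightarrow> complex ^ 'n ^ 'n) \<Rightarrow> bool" where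
  "instrument B \<longleftrightarrow> (\<forall>b. completely_positive (B b) \<and> trace_nonincreasing (B b)) \<and>
    trace_preserving (\<lambda>A. B False A + B True A)"

text \<open>
  The instrument used on input \<open>y\<close> is \<open>transform s y\<close>, its outcome \<open>b\<close> being the next argument;
  similarly for \<open>measurement s z\<close>.
\<close>

record strategy =
  preparation :: "bool \<times> bool \<Rightarrow> qubit_op"
  transform :: "bool \<Rightarrow> bool \<Rightarrow> qubit_op \<Rightarrow> qubit_op"
  measurement :: "bool \<Rightarrow> bool \<Rightarrow> qubit_op"

definition valid_strategy :: "strategy \<Rightarrow> bool" where
  "valid_strategy s \<longleftrightarrow>
    (\<forall>x. density_op (preparation s x)) \<and>
    (\<forall>y. instrument (transform s y)) \<and>
    (\<forall>z. povm (measurement s z))"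

text \<open>
  The trace is real, being that of a product of two positive semidefinite operators.
\<close>

definition prob_det :: "strategy \<Rightarrow> bool \<Rightarrow> bool \<Rightarrow> bool \<times> bool \<Rightarrow> bool \<Rightarrow> bool \<Rightarrow> real" where
  "prob_det s b c x y z =
    Re (trace (transform s y b (preparation s x) ** measurement s z c))"

text \<open>
  Shared randomness is a probability space \<open>M\<close> that does not depend on the inputs; the strategy
  employed is a random variable on it. Measurability is required for each operator and, for the
  instruments, pointwise on operators.
\<close>

definition shared_strategy :: "'w measure \<Rightarrow> ('w \<Rightarrow> strategy) \<Rightarrow> bool" where
  "shared_strategy M S \<longleftrightarrow>
    prob_space M \<and>
    (\<forall>\<omega>\<in>space M. valid_strategy (S \<omega>)) \<and>
    (\<forall>x. (\<lambda>\<omega>. preparation (S \<omega>) x) \<in> borel_measurable M) \<and>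
    (\<forall>y b A. (\<lambda>\<omega>. transform (S \<omega>) y b A) \<in> borel_measurable M) \<and>
    (\<forall>z c. (\<lambda>\<omega>. measurement (S \<omega>) z c) \<in> borel_measurable M)"

definition prob_outcome :: "'w measure \<Rightarrow> ('w \<Rightarrow> strategy) \<Rightarrow>
    bool \<Rightarrow> bool \<Rightarrow> bool \<times> bool \<Rightarrow> bool \<Rightarrow> bool \<Rightarrow> real" where
  "prob_outcome M S b c x y z = (LINT \<omega>|M. prob_det (S \<omega>) b c x y z)"

text \<open>
  The choice \<open>z = 0\<close> is immaterial, see \<open>prob_bob_eq\<close> below.
\<close>

definition prob_bob :: "'w measure \<Rightarrow> ('w \<Rightarrow> strategy) \<Rightarrow> bool \<Rightarrow> bool \<times> bool \<Rightarrow> bool \<Rightarrow> real" where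
  "prob_bob M S b x y = (\<Sum>c\<in>UNIV. prob_outcome M S b c x y False)"

definition prob_charlie :: "'w measure \<Rightarrow> ('w \<Rightarrow> strategy) \<Rightarrow> bool \<Rightarrow> bool \<times> bool \<Rightarrow> bool \<Rightarrow> real" where
  "prob_charlie M S c x z = 1 / 2 * (\<Sum>y\<in>UNIV. \<Sum>b\<in>UNIV. prob_outcome M S b c x y z)"

definition input_bit :: "bool \<times> bool \<Rightarrow> bool \<Rightarrow> bool" where
  "input_bit x y = (if y then snd x else fst x)"

definition success_prob :: "real \<Rightarrow> 'w measure \<Rightarrow> ('w \<Rightarrow> strategy) \<Rightarrow> real" where
  "success_prob \<alpha> M S =
    \<alpha> / 8 * (\<Sum>x\<in>UNIV. \<Sum>y\<in>UNIV. prob_bob M S (input_bit x y) x y) +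
    (1 - \<alpha>) / 8 * (\<Sum>x\<in>UNIV. \<Sum>z\<in>UNIV. prob_charlie M S (input_bit x z) x z)"


lemma vector_space_cscale:
  "vector_space (cscale :: complex \<Rightarrow> complex ^ 'n ^ 'm \<Rightarrow> complex ^ 'n ^ 'm)"
  by unfold_locales (simp_all add: cscale_def vec_eq_iff algebra_simps)

lemma linear_map_iff:
  "linear_map \<Phi> \<longleftrightarrow>
    (\<forall>A B. \<Phi> (A + B) = \<Phi> A + \<Phi> B) \<and> (\<forall>c A. \<Phi> (cscale c A) = cscale c (\<Phi> A))"
  by (simp add: linear_map_def Vector_Spaces.linear_iff vector_space_cscale)

lemma cdot_axis_pair:
  fixes A :: qubit_op
  assumes "v = (\<chi> i. if i = 1 then a else b)"
  shows "cdot v (A *v v) =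
    cnj a * a * A$1$1 + cnj a * b * A$1$2 + cnj b * a * A$2$1 + cnj b * b * A$2$2"
  by (simp add: assms cdot_def matrix_vector_mult_def sum_2 algebra_simps)

lemma pos_semidef_diag:
  fixes A :: qubit_op
  assumes "pos_semidef A"
  shows "A$1$1 \<in> \<real>\<^sub>\<ge>\<^sub>0" "A$2$2 \<in> \<real>\<^sub>\<ge>\<^sub>0"
proof -
  have q: "cnj a * a * A$1$1 + cnj a * b * A$1$2 + cnj b * a * A$2$1 + cnj b * b * A$2$2 \<in> \<real>\<^sub>\<ge>\<^sub>0"
    for a b
    using assms cdot_axis_pair[OF refl, of a b A] unfolding pos_semidef_def by metis
  show "A$1$1 \<in> \<real>\<^sub>\<ge>\<^sub>0" using q[of 1 0] by simp
  show "A$2$2 \<in> \<real>\<^sub>\<ge>\<^sub>0" using q[of 0 1] by simp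
qed

lemma pos_semidef_entry_le:
  fixes A :: qubit_op
  assumes "pos_semidef A"
  shows "cmod (A $ i $ j) \<le> Re (trace A)"
proof -
  have q: "cnj a * a * A$1$1 + cnj a * b * A$1$2 + cnj b * a * A$2$1 + cnj b * b * A$2$2 \<in> \<real>\<^sub>\<ge>\<^sub>0"
    for a b
    using assms cdot_axis_pair[OF refl, of a b A] unfolding pos_semidef_def by metis
  have d: "Im (A$1$1) = 0" "Im (A$2$2) = 0" "Re (A$1$1) \<ge> 0" "Re (A$2$2) \<ge> 0"
    using pos_semidef_diag[OF assms] by (auto simp: complex_nonneg_Reals_iff)
  have im: "Im (A$2$1) = - Im (A$1$2)" using q[of 1 1] d by (simp add: complex_nonneg_Reals_iff)
  have re: "Re (A$2$1) = Re (A$1$2)" using q[of 1 \<i>] d by (simp add: complex_nonneg_Reals_iff)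
  have herm: "A$2$1 = cnj (A$1$2)" using im re by (simp add: complex_eq_iff)
  have off: "cmod (A$1$2) \<le> Re (trace A)"
  proof (cases "A$1$2 = 0")
    case True
    then show ?thesis using d by (simp add: trace_def sum_2)
  next
    case False
    define r where "r = cmod (A$1$2)"
    have r: "r > 0" using False by (simp add: r_def)
    define c where "c = - cnj (A$1$2) / of_real r"
    have rr: "A$1$2 * cnj (A$1$2) = of_real r * of_real r"
      by (simp add: r_def complex_norm_square[symmetric] flip: of_real_mult power2_eq_square)
    have "c * A$1$2 = - of_real r" "cnj c * A$2$1 = - of_real r" "cnj c * c = 1"
      using rr r by (simp_all add: c_def herm field_simps)
    moreover have "A$1$1 + c * A$1$2 + cnj c * A$2$1 + cnj c * c * A$2$2 \<in> \<real>\<^sub>\<ge>\<^sub>0"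
      using q[of 1 c] by simp
    ultimately have "Re (A$1$1 - of_real r - of_real r + A$2$2) \<ge> 0"
      by (simp add: complex_nonneg_Reals_iff)
    then show ?thesis using d r by (simp add: trace_def sum_2 r_def)
  qed
  have diag: "cmod (A$1$1) \<le> Re (trace A)" "cmod (A$2$2) \<le> Re (trace A)"
    using d by (simp_all add: trace_def sum_2 cmod_eq_Re)
  show ?thesis
    using exhaust_2[of i] exhaust_2[of j] off diag herm by auto
qed

lemma completely_positive_pos_semidef:
  assumes "completely_positive \<Phi>" "pos_semidef A"
  shows "pos_semidef (\<Phi> A)"
proof -
  have one: "block_pos_semidef 1 (\<lambda>i j. X) \<longleftrightarrow> pos_semidef X" for X :: "complex ^ 'k ^ 'k"
  proof
    show "pos_semidef X" if "block_pos_semidef 1 (\<lambda>i j. X)"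
      unfolding pos_semidef_def
    proof
      fix v
      show "cdot v (X *v v) \<in> \<real>\<^sub>\<ge>\<^sub>0"
        using that unfolding block_pos_semidef_def by (auto dest: spec[of _ "\<lambda>_. v"])
    qed
  qed (simp add: block_pos_semidef_def pos_semidef_def)
  show ?thesis
    using assms one[of A] one[of "\<Phi> A"] unfolding completely_positive_def by blast
qed

lemma prob_det_le:
  assumes "valid_strategy s"
  shows "\<bar>prob_det s b c x y z\<bar> \<le> 8"
proof -
  let ?r = "preparation s x" and ?B = "transform s y b" and ?C = "measurement s z"
  have r: "pos_semidef ?r" "trace ?r = 1" and B: "completely_positive ?B" "trace_nonincreasing ?B"
    and C: "pos_semidef (?C False)" "pos_semidef (?C True)" "?C False + ?C True = mat 1"
    using assms by (simp_all add: valid_strategy_def density_op_def instrument_def povm_def del: split_paired_All)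
  have p: "pos_semidef (?B r)" if "pos_semidef r" for r
    using completely_positive_pos_semidef[OF B(1) that] .
  have "Re (trace (?B ?r)) \<le> 1"
    using B(2) r by (auto simp: trace_nonincreasing_def)
  then have 1: "cmod (?B ?r $ i $ j) \<le> 1" for i j
    using pos_semidef_entry_le[OF p[OF r(1)], of i j] by linarith
  have "trace (?C False) + trace (?C True) = 2"
    using C(3) by (simp flip: trace_add) (simp add: trace_I)
  moreover have "Re (trace (?C False)) \<ge> 0" "Re (trace (?C True)) \<ge> 0"
    using C(1,2) by (metis norm_ge_zero order_trans pos_semidef_entry_le)+
  ultimately have "Re (trace (?C c)) \<le> 2"
    by (cases c) (auto simp: complex_eq_iff)
  then have 2: "cmod (?C c $ i $ j) \<le> 2" for i j
    using C pos_semidef_entry_le[of "?C c" i j] by (cases c) auto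
  have m: "cmod (?B ?r $ i $ j * ?C c $ k $ l) \<le> 2" for i j k l
    using mult_mono[OF 1[of i j] 2[of k l]] by (simp add: norm_mult)
  have "cmod (trace (?B ?r ** ?C c)) \<le> (\<Sum>i\<in>(UNIV::2 set). \<Sum>j\<in>(UNIV::2 set). 2)"
    unfolding trace_def matrix_matrix_mult_def vec_lambda_beta by (intro sum_norm_le m)
  also have "\<dots> = 8" by simp
  finally have "cmod (trace (?B ?r ** ?C c)) \<le> 8" .
  then show ?thesis
    unfolding prob_det_def using abs_Re_le_cmod order_trans by blast
qed

lemma linear_map_expand:
  fixes A :: qubit_op
  assumes "linear_map \<Phi>"
  shows "\<Phi> A = (\<Sum>i\<in>UNIV. \<Sum>j\<in>UNIV. cscale (A $ i $ j) (\<Phi> (axis i (axis j 1))))"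
proof -
  interpret Vector_Spaces.linear cscale cscale \<Phi>
    using assms by (simp add: linear_map_def)
  have "A = (\<Sum>i\<in>UNIV. \<Sum>j\<in>UNIV. cscale (A $ i $ j) (axis i (axis j 1)))"
    by (simp add: vec_eq_iff forall_2 sum_2 cscale_def axis_def)
  then have "\<Phi> A = \<Phi> (\<Sum>i\<in>UNIV. \<Sum>j\<in>UNIV. cscale (A $ i $ j) (axis i (axis j 1)))"
    by simp
  also have "\<dots> = (\<Sum>i\<in>UNIV. \<Sum>j\<in>UNIV. cscale (A $ i $ j) (\<Phi> (axis i (axis j 1))))"
    by (simp add: sum scale)
  finally show ?thesis .
qed

lemma measurable_vec_nth [measurable]:
  fixes f :: "'w \<Rightarrow> 'a::real_normed_vector ^ 'n"
  assumes "f \<in> borel_measurable M"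
  shows "(\<lambda>\<omega>. f \<omega> $ i) \<in> borel_measurable M"
  by (rule borel_measurable_continuous_on[OF _ assms]) (intro continuous_intros)

lemma prob_det_measurable:
  assumes "shared_strategy M S"
  shows "(\<lambda>\<omega>. prob_det (S \<omega>) b c x y z) \<in> borel_measurable M"
proof -
  have [measurable]: "(\<lambda>\<omega>. preparation (S \<omega>) x) \<in> borel_measurable M"
    "\<And>A. (\<lambda>\<omega>. transform (S \<omega>) y b A) \<in> borel_measurable M"
    "(\<lambda>\<omega>. measurement (S \<omega>) z c) \<in> borel_measurable M"
    using assms by (simp_all add: shared_strategy_def del: split_paired_All)
  have lin: "linear_map (transform (S \<omega>) y b)" if "\<omega> \<in> space M" for \<omega>
    using assms that
    by (auto simp: shared_strategy_def valid_strategy_def instrument_def completely_positive_def)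
  have "(\<lambda>\<omega>. Re (\<Sum>k\<in>UNIV. \<Sum>l\<in>UNIV.
      (\<Sum>i\<in>UNIV. \<Sum>j\<in>UNIV. preparation (S \<omega>) x $ i $ j *
        transform (S \<omega>) y b (axis i (axis j 1)) $ k $ l) * measurement (S \<omega>) z c $ l $ k))
    \<in> borel_measurable M" (is "?f \<in> _")
    by measurable
  also have "?f \<in> borel_measurable M \<longleftrightarrow> ?thesis"
    by (intro measurable_cong)
      (simp add: prob_det_def trace_def matrix_matrix_mult_def
        linear_map_expand[OF lin, of _ "preparation _ x"] cscale_def)
  finally show ?thesis .
qed

lemma prob_det_integrable:
  assumes "shared_strategy M S"
  shows "integrable M (\<lambda>\<omega>. prob_det (S \<omega>) b c x y z)"
proof -
  interpret prob_space M using assms by (simp add: shared_strategy_def)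
  show ?thesis
    using assms
    by (intro integrable_const_bound[where B = 8] prob_det_measurable AE_I2)
      (auto simp: shared_strategy_def intro: prob_det_le)
qed

lemma prob_det_sum:
  assumes "valid_strategy s"
  shows "(\<Sum>c\<in>UNIV. prob_det s b c x y z) = Re (trace (transform s y b (preparation s x)))"
proof -
  have "measurement s z False + measurement s z True = mat 1"
    using assms by (simp add: valid_strategy_def povm_def)
  then show ?thesis
    by (simp add: UNIV_bool prob_det_def flip: plus_complex.sel trace_add matrix_add_ldistrib)
qed

lemma prob_bob_eq:
  assumes "shared_strategy M S"
  shows "prob_bob M S b x y = (\<Sum>c\<in>UNIV. prob_outcome M S b c x y z)"
proof -
  have "(\<Sum>c\<in>UNIV. prob_outcome M S b c x y z) =
    (LINT \<omega>|M. Re (trace (transform (S \<omega>) y b (preparation (S \<omega>) x))))" for z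
  proof -
    have "(\<Sum>c\<in>UNIV. prob_outcome M S b c x y z) = (LINT \<omega>|M. (\<Sum>c\<in>UNIV. prob_det (S \<omega>) b c x y z))"
      unfolding prob_outcome_def by (simp add: prob_det_integrable[OF assms])
    also have "\<dots> = (LINT \<omega>|M. Re (trace (transform (S \<omega>) y b (preparation (S \<omega>) x))))"
      using assms by (intro Bochner_Integration.integral_cong refl prob_det_sum)
        (auto simp: shared_strategy_def)
    finally show ?thesis .
  qed
  then show ?thesis by (simp add: prob_bob_def)
qed

end

theory Submission
  imports Defs
begin

text \<open>
  By linearity in the shared randomness it suffices to treat a deterministic strategy. Let
  \<open>d\<^sub>y\<close> be the signed sum over \<open>x\<close> of Alice's halved Bloch vectors, with sign
  \<open>(-1)\<close> to the power \<open>x\<^sub>y\<close>; then \<open>\<bar>d\<^sub>0 \<plusminus> d\<^sub>1\<bar> \<le> 2\<close>. For each \<open>y\<close>, Bob's instrument followed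
  by Charlie's measurement is a four-outcome POVM on Alice's qubit, so a sum of responses to
  traceless operators, one for each outcome pair, is at most twice the largest Bloch length.
  Group Bob's guess of \<open>x\<^sub>y\<close> with Charlie's guess of the other bit: these two contribute at most
  a multiple of \<open>\<bar>2\<alpha> d\<^sub>y \<plusminus> (1 - \<alpha>) d\<^bsub>1-y\<^esub>\<bar>\<close>, while Charlie's guess of \<open>x\<^sub>y\<close> contributes at most
  \<open>(1 - \<alpha>) \<bar>d\<^sub>y\<bar>\<close>. Summing over \<open>y\<close> with Cauchy-Schwarz gives the bound.
\<close>

section \<open>Bloch coordinates and positivity of qubit operators\<close>

text \<open>
  Here \<open>t\<close> is half the trace, so a density operator has \<open>t = 1 / 2\<close> and \<open>d\<close> is half its
  Bloch vector.
\<close>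

definition bloch_op :: "real \<Rightarrow> real ^ 3 \<Rightarrow> qubit_op" where
  "bloch_op t d = vector [vector [of_real (t + d $ 3), Complex (d $ 1) (- d $ 2)],
                          vector [Complex (d $ 1) (d $ 2), of_real (t - d $ 3)]]"

lemma bloch_op_nth [simp]:
  "bloch_op t d $ 1 $ 1 = of_real (t + d $ 3)" "bloch_op t d $ 1 $ 2 = Complex (d $ 1) (- d $ 2)"
  "bloch_op t d $ 2 $ 1 = Complex (d $ 1) (d $ 2)" "bloch_op t d $ 2 $ 2 = of_real (t - d $ 3)"
  by (simp_all add: bloch_op_def)

lemma bloch_op_add: "bloch_op s d + bloch_op t e = bloch_op (s + t) (d + e)"
  by (simp add: vec_eq_iff forall_2 complex_eq_iff)

lemma bloch_op_scaleR: "cscale (of_real r) (bloch_op t d) = bloch_op (r * t) (r *\<^sub>R d)"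
  by (simp add: vec_eq_iff forall_2 complex_eq_iff cscale_def algebra_simps)

lemma trace_bloch_op: "trace (bloch_op t d) = of_real (2 * t)"
  by (simp add: trace_def sum_2 complex_eq_iff)

lemma trace_bloch_op_mult:
  "Re (trace (bloch_op s d ** bloch_op t e)) = 2 * (s * t + d \<bullet> e)"
  by (simp add: trace_def matrix_matrix_mult_def sum_2 inner_vec_def sum_3 algebra_simps)

lemma norm_vec3_le_iff:
  fixes d :: "real ^ 3"
  assumes "0 \<le> t"
  shows "norm d \<le> t \<longleftrightarrow> (d $ 1)\<^sup>2 + (d $ 2)\<^sup>2 + (d $ 3)\<^sup>2 \<le> t\<^sup>2"
proof -
  have "norm d \<le> t \<longleftrightarrow> d \<bullet> d \<le> t\<^sup>2"
    using assms by (metis dot_square_norm norm_ge_zero power2_le_iff_abs_le abs_norm_cancel)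
  then show ?thesis
    by (simp add: inner_vec_def sum_3 power2_eq_square)
qed

text \<open>The quadratic form at \<open>v\<close> is \<open>t * w + d \<bullet> e\<close>, where
  \<open>e\<close> is the Bloch vector of the unnormalised pure state \<open>v\<close> and
  \<open>w\<close> is the squared length of \<open>v\<close>. Cauchy-Schwarz with
  \<open>norm e \<le> w\<close> finishes.\<close>

lemma pos_semidef_bloch_op:
  assumes "norm d \<le> t"
  shows "pos_semidef (bloch_op t d)"
  unfolding pos_semidef_def
proof
  fix v :: "complex ^ 2"
  let ?a = "v $ 1" and ?b = "v $ 2"
  define e :: "real ^ 3" where
    "e = vector [2 * Re (cnj ?a * ?b), 2 * Im (cnj ?a * ?b), (cmod ?a)\<^sup>2 - (cmod ?b)\<^sup>2]"
  define w where "w = (cmod ?a)\<^sup>2 + (cmod ?b)\<^sup>2"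
  have w: "w \<ge> 0" by (simp add: w_def)
  have "norm e \<le> w"
    unfolding norm_vec3_le_iff[OF w]
    by (simp add: e_def w_def cmod_power2) (simp add: power2_eq_square algebra_simps)
  then have "norm d * norm e \<le> t * w"
    using assms by (intro mult_mono) (auto intro: order_trans[OF norm_ge_zero])
  moreover have "- (d \<bullet> e) \<le> norm d * norm e"
    using Cauchy_Schwarz_ineq2[of d e] by linarith
  ultimately have "0 \<le> t * w + d \<bullet> e" by linarith
  moreover have "cdot v (bloch_op t d *v v) = of_real (t * w + d \<bullet> e)"
    by (simp add: cdot_def matrix_vector_mult_def sum_2 complex_eq_iff e_def w_def inner_vec_def
        sum_3 cmod_power2) (simp add: power2_eq_square algebra_simps)
  ultimately show "cdot v (bloch_op t d *v v) \<in> \<real>\<^sub>\<ge>\<^sub>0"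
    by (simp del: of_real_add of_real_mult)
qed

lemma pos_semidefE_bloch_op:
  fixes A :: qubit_op
  assumes "pos_semidef A"
  obtains t d where "norm d \<le> t" "A = bloch_op t d"
proof -
  have q: "cnj a * a * A$1$1 + cnj a * b * A$1$2 + cnj b * a * A$2$1 + cnj b * b * A$2$2 \<in> \<real>\<^sub>\<ge>\<^sub>0"
    for a b
    using assms cdot_axis_pair[OF refl, of a b A] unfolding pos_semidef_def by metis
  have real: "Im (A$1$1) = 0" "Im (A$2$2) = 0" "Re (A$1$1) \<ge> 0" "Re (A$2$2) \<ge> 0"
    using pos_semidef_diag[OF assms] by (auto simp: complex_nonneg_Reals_iff)
  have herm: "Im (A$2$1) = - Im (A$1$2)" "Re (A$2$1) = Re (A$1$2)"
    using q[of 1 1] q[of 1 \<i>] real by (simp_all add: complex_nonneg_Reals_iff)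
  define p where "p = Re (A$1$1)"
  define s where "s = Re (A$2$2)"
  define x where "x = Re (A$1$2)"
  define y where "y = Im (A$1$2)"
  have A: "A$1$1 = of_real p" "A$2$2 = of_real s" "A$1$2 = Complex x y" "A$2$1 = Complex x (- y)"
    using real herm by (simp_all add: p_def s_def x_def y_def complex_eq_iff)
  have ps: "p \<ge> 0" "s \<ge> 0" using real by (simp_all add: p_def s_def)
  have det: "x\<^sup>2 + y\<^sup>2 \<le> p * s"
  proof (cases "p + s = 0")
    case True
    then have "p = 0" "s = 0" using ps by auto
    moreover have "cmod (A$1$2) \<le> 0"
      using pos_semidef_entry_le[OF assms, of 1 2] calculation A by (simp add: trace_def sum_2)
    ultimately show ?thesis by (simp add: A complex_eq_iff)
  next
    case False
    \<comment> \<open>The test vectors here and below come from the adjugate matrix: the form takes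
      the values \<open>p\<close> and \<open>s\<close> times the determinant at them. Adding the two
      covers the case where one diagonal entry vanishes.\<close>
    have "0 \<le> p * (p * s - (x\<^sup>2 + y\<^sup>2))"
      using q[of "- Complex x y" "of_real p"]
      by (simp add: A complex_nonneg_Reals_iff power2_eq_square algebra_simps)
    moreover have "0 \<le> s * (p * s - (x\<^sup>2 + y\<^sup>2))"
      using q[of "of_real s" "- Complex x (- y)"]
      by (simp add: A complex_nonneg_Reals_iff power2_eq_square algebra_simps)
    ultimately have "0 \<le> (p + s) * (p * s - (x\<^sup>2 + y\<^sup>2))"
      by (simp add: distrib_right)
    with False ps show ?thesis by (simp add: zero_le_mult_iff)
  qed
  define d :: "real ^ 3" where "d = vector [x, - y, (p - s) / 2]"
  have "norm d \<le> (p + s) / 2"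
    using norm_vec3_le_iff[of "(p + s) / 2" d] ps det
    by (simp add: d_def power2_eq_square field_simps)
  moreover have "A = bloch_op ((p + s) / 2) d"
    by (simp add: vec_eq_iff forall_2 complex_eq_iff A d_def field_simps)
  ultimately show thesis by (rule that)
qed

lemma trace_pos_semidef_mult_nonneg:
  fixes A B :: qubit_op
  assumes "pos_semidef A" "pos_semidef B"
  shows "0 \<le> Re (trace (A ** B))"
proof -
  obtain s d where A: "norm d \<le> s" "A = bloch_op s d"
    using pos_semidefE_bloch_op[OF assms(1)] .
  obtain t e where B: "norm e \<le> t" "B = bloch_op t e"
    using pos_semidefE_bloch_op[OF assms(2)] .
  have "norm d * norm e \<le> s * t"
    using A(1) B(1) by (intro mult_mono) (auto intro: order_trans[OF norm_ge_zero])
  then show ?thesis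
    using Cauchy_Schwarz_ineq2[of d e] by (simp add: A(2) B(2) trace_bloch_op_mult)
qed

lemma density_opE_bloch_op:
  fixes \<rho> :: qubit_op
  assumes "density_op \<rho>"
  obtains d where "norm d \<le> 1 / 2" "\<rho> = bloch_op (1 / 2) d"
proof -
  obtain t d where "norm d \<le> t" "\<rho> = bloch_op t d"
    using assms pos_semidefE_bloch_op unfolding density_op_def by metis
  moreover from this have "t = 1 / 2"
    using assms by (simp add: density_op_def trace_bloch_op complex_eq_iff)
  ultimately show thesis using that by blast
qed

section \<open>Responses of the outcome pairs as functionals of Alice's operator\<close>

text \<open>This extends \<open>prob_det\<close> from the prepared state to an arbitrary operator,
  so that linearity allows evaluation at traceless operators and at the identity.\<close>

definition outcome_fun :: "strategy \<Rightarrow> bool \<Rightarrow> bool \<Rightarrow> bool \<Rightarrow> bool \<Rightarrow> qubit_op \<Rightarrow> real" where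
  "outcome_fun s y z b c A = Re (trace (transform s y b A ** measurement s z c))"

abbreviation outcome_dir :: "strategy \<Rightarrow> bool \<Rightarrow> bool \<Rightarrow> bool \<Rightarrow> bool \<Rightarrow> real ^ 3 \<Rightarrow> real" where
  "outcome_dir s y z b c d \<equiv> outcome_fun s y z b c (bloch_op 0 d)"

context
  fixes s :: strategy
  assumes valid: "valid_strategy s"
begin

lemma linear_map_transform: "linear_map (transform s y b)"
  using valid by (simp add: valid_strategy_def instrument_def completely_positive_def)

lemma outcome_fun_add: "outcome_fun s y z b c (A + B) = outcome_fun s y z b c A + outcome_fun s y z b c B"
proof -
  have "trace ((X + Y) ** C) = trace (X ** C) + trace (Y ** C)" for X Y C :: qubit_op
    by (simp add: trace_def matrix_matrix_mult_def sum_2 algebra_simps)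
  then show ?thesis
    using linear_map_transform[of y b] by (simp add: outcome_fun_def linear_map_iff)
qed

lemma outcome_fun_scale:
  "outcome_fun s y z b c (cscale (of_real r) A) = r * outcome_fun s y z b c A"
proof -
  have "trace (cscale (of_real r) B ** C) = of_real r * trace (B ** C)" for B C :: qubit_op
    by (simp add: cscale_def trace_def matrix_matrix_mult_def sum_2 algebra_simps)
  then show ?thesis
    using linear_map_transform[of y b] by (simp add: outcome_fun_def linear_map_iff)
qed

lemma linear_outcome_dir: "linear (outcome_dir s y z b c)"
proof (rule linearI)
  show "outcome_dir s y z b c (d + e) = outcome_dir s y z b c d + outcome_dir s y z b c e" for d e
    using outcome_fun_add[of y z b c "bloch_op 0 d" "bloch_op 0 e"] by (simp add: bloch_op_add)
  show "outcome_dir s y z b c (r *\<^sub>R d) = r *\<^sub>R outcome_dir s y z b c d" for r d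
    using outcome_fun_scale[of y z b c r "bloch_op 0 d"] by (simp add: bloch_op_scaleR)
qed

lemma outcome_fun_bloch_op:
  "outcome_fun s y z b c (bloch_op t d) =
    t * outcome_fun s y z b c (bloch_op 1 0) + outcome_dir s y z b c d"
proof -
  have "bloch_op t d = cscale (of_real t) (bloch_op 1 0) + bloch_op 0 d"
    by (simp add: bloch_op_scaleR bloch_op_add)
  then show ?thesis by (simp only: outcome_fun_add outcome_fun_scale)
qed

text \<open>The operator \<open>bloch_op (norm d) (- d)\<close> is positive, hence so is its
  response, which is the right side minus the left side.\<close>

lemma outcome_dir_le:
  "outcome_dir s y z b c d \<le> norm d * outcome_fun s y z b c (bloch_op 1 0)"
proof -
  have "pos_semidef (transform s y b (bloch_op (norm d) (- d)))"
  proof (rule completely_positive_pos_semidef[of "transform s y b"])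
    show "completely_positive (transform s y b)"
      using valid by (simp add: valid_strategy_def instrument_def)
    show "pos_semidef (bloch_op (norm d) (- d))"
      by (rule pos_semidef_bloch_op) simp
  qed
  moreover have "pos_semidef (measurement s z c)"
    using valid by (simp add: valid_strategy_def povm_def)
  ultimately have "0 \<le> outcome_fun s y z b c (bloch_op (norm d) (- d))"
    unfolding outcome_fun_def by (rule trace_pos_semidef_mult_nonneg)
  then show ?thesis
    using outcome_fun_bloch_op[of y z b c "norm d" "- d"] linear_neg[OF linear_outcome_dir, of y z b c d]
    by simp
qed

lemma outcome_fun_sum_c:
  "outcome_fun s y z b False A + outcome_fun s y z b True A = Re (trace (transform s y b A))"
proof -
  have "measurement s z False + measurement s z True = mat 1"
    using valid by (simp add: valid_strategy_def povm_def)
  then show ?thesis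
    by (simp add: outcome_fun_def flip: plus_complex.sel trace_add matrix_add_ldistrib)
qed

lemma transform_sum_b:
  "Re (trace (transform s y False A)) + Re (trace (transform s y True A)) = Re (trace A)"
proof -
  have "trace (transform s y False A + transform s y True A) = trace A"
    using valid by (simp add: valid_strategy_def instrument_def trace_preserving_def)
  then show ?thesis by (metis plus_complex.sel(1) trace_add)
qed

lemma outcome_fun_sum_bc:
  "outcome_fun s y z False False A + outcome_fun s y z False True A +
   outcome_fun s y z True False A + outcome_fun s y z True True A = Re (trace A)"
  using outcome_fun_sum_c[of y z False A] outcome_fun_sum_c[of y z True A] transform_sum_b[of y A]
  by linarith

text \<open>Each response is at most \<open>N\<close> times the weight of its outcome pair, the
  response to the identity \<open>bloch_op 1 0\<close>. The four weights add up to the trace of the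
  identity, which is 2.\<close>

lemma outcome_dir_sum_le:
  assumes "\<And>b c. norm (d b c) \<le> N"
  shows "outcome_dir s y z False False (d False False) + outcome_dir s y z False True (d False True) +
    outcome_dir s y z True False (d True False) + outcome_dir s y z True True (d True True) \<le> 2 * N"
proof -
  let ?w = "\<lambda>b c. outcome_fun s y z b c (bloch_op 1 0)"
  have "outcome_dir s y z b c (d b c) \<le> N * ?w b c" for b c
  proof -
    \<comment> \<open>Any unit vector would do: adding the bounds for \<open>e\<close> and
      \<open>- e\<close> shows that the weight is nonnegative.\<close>
    define e :: "real ^ 3" where "e = axis 1 1"
    have "norm e = 1" by (simp add: e_def)
    then have "0 \<le> ?w b c"
      using outcome_dir_le[of y z b c e] outcome_dir_le[of y z b c "- e"]
        linear_neg[OF linear_outcome_dir, of y z b c e] by simp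
    then have "norm (d b c) * ?w b c \<le> N * ?w b c"
      using assms by (intro mult_right_mono)
    then show ?thesis using outcome_dir_le[of y z b c "d b c"] by linarith
  qed
  note this[of False False] this[of False True] this[of True False] this[of True True]
  moreover have "N * ?w False False + N * ?w False True + N * ?w True False + N * ?w True True = 2 * N"
    using outcome_fun_sum_bc[of y z "bloch_op 1 0"]
    by (simp add: trace_bloch_op flip: distrib_left)
  ultimately show ?thesis by linarith
qed

end

section \<open>Reduction to fixed strategies and norm estimates\<close>

lemma add_le_sqrt_two:
  fixes a b :: real
  shows "a + b \<le> sqrt 2 * sqrt (a\<^sup>2 + b\<^sup>2)"
proof -
  have "a + b \<le> sqrt (2 * (a\<^sup>2 + b\<^sup>2))"
    using zero_le_power2[of "a - b"] by (intro real_le_rsqrt) (simp add: power2_sum power2_diff)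
  then show ?thesis by (simp only: real_sqrt_mult)
qed

definition det_success :: "real \<Rightarrow> strategy \<Rightarrow> real" where
  "det_success \<alpha> s =
    \<alpha> / 8 * (\<Sum>x\<in>UNIV. \<Sum>y\<in>UNIV. \<Sum>c\<in>UNIV. prob_det s (input_bit x y) c x y False) +
    (1 - \<alpha>) / 8 * (\<Sum>x\<in>UNIV. \<Sum>z\<in>UNIV.
      1 / 2 * (\<Sum>y\<in>UNIV. \<Sum>b\<in>UNIV. prob_det s b (input_bit x z) x y z))"

lemma success_prob_eq_integral:
  assumes "shared_strategy M S"
  shows "success_prob \<alpha> M S = (LINT \<omega>|M. det_success \<alpha> (S \<omega>))"
  unfolding success_prob_def det_success_def prob_bob_def prob_charlie_def prob_outcome_def
  by (simp add: prob_det_integrable[OF assms] del: split_paired_All)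

definition bit_sign :: "bool \<Rightarrow> real" where
  "bit_sign b = (if b then - 1 else 1)"

text \<open>Replacing the inner product by \<open>g\<close> makes the bound independent of both
  signs, so it serves all four outcome pairs at once.\<close>

lemma norm_signed_comb_le:
  fixes d e :: "'a :: real_inner"
  assumes "\<bar>d \<bullet> e\<bar> \<le> g" "0 \<le> p" "0 \<le> q"
  shows "norm ((p * bit_sign b) *\<^sub>R d + (q * bit_sign c) *\<^sub>R e) \<le>
    sqrt (p\<^sup>2 * (norm d)\<^sup>2 + q\<^sup>2 * (norm e)\<^sup>2 + 2 * p * q * g)"
proof -
  have "(norm (s *\<^sub>R d + t *\<^sub>R e))\<^sup>2 = s\<^sup>2 * (norm d)\<^sup>2 + t\<^sup>2 * (norm e)\<^sup>2 + 2 * (s * t) * (d \<bullet> e)" for s t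
    unfolding power2_norm_eq_inner
    by (simp add: inner_add_left inner_add_right inner_commute[of e d] power2_eq_square
        algebra_simps)
  then have "(norm ((p * bit_sign b) *\<^sub>R d + (q * bit_sign c) *\<^sub>R e))\<^sup>2 =
    p\<^sup>2 * (norm d)\<^sup>2 + q\<^sup>2 * (norm e)\<^sup>2 + 2 * (p * q) * (bit_sign b * bit_sign c * (d \<bullet> e))"
    by (simp add: bit_sign_def)
  also have "bit_sign b * bit_sign c * (d \<bullet> e) \<le> g"
    using assms(1) by (simp add: bit_sign_def abs_le_iff)
  finally show ?thesis
    using assms(2,3) by (intro real_le_rsqrt) (simp add: mult_left_mono mult.assoc)
qed

text \<open>The first two terms share Charlie's input \<open>\<not> y\<close>, so by linearity they
  are the response of one POVM to a single signed vector. The third has Charlie's input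
  \<open>y\<close> and is estimated separately. It is applied with \<open>p = 2 * \<alpha>\<close>
  and \<open>q = 1 - \<alpha>\<close>.\<close>

lemma bob_charlie_bound:
  fixes d :: "bool \<Rightarrow> real ^ 3"
  assumes valid: "valid_strategy s"
    and "0 \<le> p" "0 \<le> q" "norm (d False + d True) \<le> 2" "norm (d False - d True) \<le> 2"
  shows "(\<Sum>y\<in>UNIV. \<Sum>b\<in>UNIV. \<Sum>c\<in>UNIV.
      p * bit_sign b * outcome_dir s y (\<not> y) b c (d y) +
      q * bit_sign c * outcome_dir s y (\<not> y) b c (d (\<not> y)) +
      q * bit_sign c * outcome_dir s y y b c (d y)) \<le> 4 * sqrt 2 * (q + sqrt (p\<^sup>2 + q\<^sup>2))"
proof -
  define g where "g = \<bar>d False \<bullet> d True\<bar>"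
  define N where "N y = sqrt (p\<^sup>2 * (norm (d y))\<^sup>2 + q\<^sup>2 * (norm (d (\<not> y)))\<^sup>2 + 2 * p * q * g)" for y
  note lin = linear_outcome_dir[OF valid]
  \<comment> \<open>The left side is the larger of the squared norms of the sum and the
    difference.\<close>
  have g: "(norm (d False))\<^sup>2 + (norm (d True))\<^sup>2 + 2 * g \<le> 4"
  proof -
    have "(norm (d False + d True))\<^sup>2 \<le> 2\<^sup>2" "(norm (d False - d True))\<^sup>2 \<le> 2\<^sup>2"
      using assms(4,5) by (simp_all only: power_mono norm_ge_zero)
    then show ?thesis
      by (simp add: g_def power2_norm_eq_inner inner_simps inner_commute[of "d True" "d False"] abs_if)
  qed
  \<comment> \<open>On input \<open>y\<close>, Bob's gain on \<open>x\<^sub>y\<close> competes with Charlie's gain on the other bit.\<close>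
  have mixed: "(\<Sum>b\<in>UNIV. \<Sum>c\<in>UNIV. p * bit_sign b * outcome_dir s y (\<not> y) b c (d y) +
      q * bit_sign c * outcome_dir s y (\<not> y) b c (d (\<not> y))) \<le> 2 * N y" for y
  proof -
    have "\<bar>d y \<bullet> d (\<not> y)\<bar> \<le> g"
      by (cases y) (simp_all add: g_def inner_commute)
    from outcome_dir_sum_le[OF valid norm_signed_comb_le[OF this assms(2,3)],
        of y "\<not> y" "\<lambda>b c. b" "\<lambda>b c. c"]
    show ?thesis
      by (simp add: N_def UNIV_bool linear_add[OF lin] linear_scale[OF lin])
  qed
  have same: "(\<Sum>b\<in>UNIV. \<Sum>c\<in>UNIV. q * bit_sign c * outcome_dir s y y b c (d y)) \<le> 2 * (q * norm (d y))"
    for y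
  proof -
    have "norm ((q * bit_sign c) *\<^sub>R d y) \<le> q * norm (d y)" for c
      using assms(3) by (simp add: bit_sign_def)
    from outcome_dir_sum_le[OF valid this, of y y "\<lambda>b c. c"] show ?thesis
      by (simp add: UNIV_bool linear_scale[OF lin])
  qed
  have "(N False)\<^sup>2 + (N True)\<^sup>2 = (p\<^sup>2 + q\<^sup>2) * ((norm (d False))\<^sup>2 + (norm (d True))\<^sup>2) + 2 * (2 * p * q) * g"
    using assms(2,3) by (simp add: N_def g_def) (simp add: algebra_simps)
  \<comment> \<open>Bounding \<open>2 * p * q\<close> by \<open>p\<^sup>2 + q\<^sup>2\<close> gives
    the inner product the same coefficient as the squared norms, so the bound \<open>g\<close>
    applies.\<close>
  also have "\<dots> \<le> (p\<^sup>2 + q\<^sup>2) * ((norm (d False))\<^sup>2 + (norm (d True))\<^sup>2) + 2 * (p\<^sup>2 + q\<^sup>2) * g"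
    using sum_squares_bound[of p q] by (intro add_left_mono mult_right_mono) (simp_all add: g_def)
  also have "\<dots> = (p\<^sup>2 + q\<^sup>2) * ((norm (d False))\<^sup>2 + (norm (d True))\<^sup>2 + 2 * g)"
    by (simp add: algebra_simps)
  also have "\<dots> \<le> (p\<^sup>2 + q\<^sup>2) * 4"
    using g by (intro mult_left_mono) auto
  finally have sq: "(N False)\<^sup>2 + (N True)\<^sup>2 \<le> (p\<^sup>2 + q\<^sup>2) * 4" .
  have "N False + N True \<le> sqrt 2 * sqrt ((N False)\<^sup>2 + (N True)\<^sup>2)"
    by (rule add_le_sqrt_two)
  also have "\<dots> \<le> sqrt 2 * sqrt ((p\<^sup>2 + q\<^sup>2) * 4)"
    using sq by (intro mult_left_mono real_sqrt_le_mono) auto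
  also have "sqrt ((p\<^sup>2 + q\<^sup>2) * 4) = sqrt (p\<^sup>2 + q\<^sup>2) * 2"
    by (simp only: real_sqrt_mult real_sqrt_four)
  finally have N: "N False + N True \<le> sqrt 2 * (sqrt (p\<^sup>2 + q\<^sup>2) * 2)" .
  have "norm (d False) + norm (d True) \<le> sqrt 2 * sqrt ((norm (d False))\<^sup>2 + (norm (d True))\<^sup>2)"
    by (rule add_le_sqrt_two)
  also have "\<dots> \<le> sqrt 2 * sqrt (2\<^sup>2)"
    using g by (intro mult_left_mono real_sqrt_le_mono) (auto simp: g_def)
  finally have "q * (norm (d False) + norm (d True)) \<le> q * (sqrt 2 * 2)"
    using assms(3) by (intro mult_left_mono) auto
  with N show ?thesis
    using mixed[of False] mixed[of True] same[of False] same[of True]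
    by (simp add: UNIV_bool algebra_simps)
qed

section \<open>Success probability of a fixed strategy\<close>

lemma sum_bool_pair: "(\<Sum>x\<in>UNIV. f x) = f (False, False) + f (False, True) + f (True, False) + f (True, True)"
proof -
  have U: "(UNIV :: (bool \<times> bool) set) = {(False, False), (False, True), (True, False), (True, True)}"
    by auto
  show ?thesis by (subst U) (simp add: add.assoc)
qed

lemma det_success_le:
  assumes "0 \<le> \<alpha>" "\<alpha> \<le> 1" and valid: "valid_strategy s"
  shows "det_success \<alpha> s \<le>
    1 / 2 + (1 - \<alpha>) / (4 * sqrt 2) + 1 / (4 * sqrt 2) * sqrt ((1 - \<alpha>)\<^sup>2 + 4 * \<alpha>\<^sup>2)"
proof -
  have "\<exists>d. norm d \<le> 1 / 2 \<and> preparation s x = bloch_op (1 / 2) d" for x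
    using valid density_opE_bloch_op unfolding valid_strategy_def by metis
  then obtain r where r: "\<And>x. norm (r x) \<le> 1 / 2" "\<And>x. preparation s x = bloch_op (1 / 2) (r x)"
    by metis
  define d where "d y = (if y
    then r (False, False) - r (False, True) + r (True, False) - r (True, True)
    else r (False, False) + r (False, True) - r (True, False) - r (True, True))" for y
  let ?w = "\<lambda>y z b c. outcome_fun s y z b c (bloch_op 1 0)"
  let ?\<psi> = "outcome_dir s"
  note lin = linear_outcome_dir[OF valid]
  note dlin = linear_add[OF lin] linear_diff[OF lin]
  have pd: "prob_det s b c x y z = ?w y z b c / 2 + ?\<psi> y z b c (r x)" for b c x y z
    using outcome_fun_bloch_op[OF valid, of y z b c "1 / 2" "r x"]
    by (simp add: prob_det_def r(2) outcome_fun_def)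
  have w: "?w y z False False + ?w y z False True + ?w y z True False + ?w y z True True = 2" for y z
    using outcome_fun_sum_bc[OF valid, of y z "bloch_op 1 0"] by (simp add: trace_bloch_op)
  \<comment> \<open>Since responses to a traceless operator cancel, those with a correct guess make
    up half of the signed sum. This gives the factor 1/2 before \<open>P\<close> and
    \<open>Q\<close> below; the constant 2 there is the share of the maximally mixed part of the
    four states.\<close>
  have \<psi>: "?\<psi> y z False False v + ?\<psi> y z False True v + ?\<psi> y z True False v + ?\<psi> y z True True v = 0"
    for y z v
    using outcome_fun_sum_bc[OF valid, of y z "bloch_op 0 v"] by (simp add: trace_bloch_op)
  define P where "P y = (\<Sum>b\<in>UNIV. \<Sum>c\<in>UNIV. bit_sign b * ?\<psi> y (\<not> y) b c (d y))" for y
  define Q where "Q y z = (\<Sum>b\<in>UNIV. \<Sum>c\<in>UNIV. bit_sign c * ?\<psi> y z b c (d z))" for y z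
  \<comment> \<open>Bob's marginal does not depend on Charlie's input, which may thus be taken to be \<open>\<not> y\<close>.\<close>
  have bob: "(\<Sum>x\<in>UNIV. \<Sum>c\<in>UNIV. prob_det s (input_bit x y) c x y False) =
2 + 1 / 2 * P y" for y
  proof -
    have "(\<Sum>c\<in>UNIV. prob_det s b c x y False) = (\<Sum>c\<in>UNIV. prob_det s b c x y (\<not> y))" for b x
      by (simp only: prob_det_sum[OF valid])
    then have "(\<Sum>x\<in>UNIV. \<Sum>c\<in>UNIV. prob_det s (input_bit x y) c x y False) =
      (\<Sum>x\<in>UNIV. \<Sum>c\<in>UNIV. prob_det s (input_bit x y) c x y (\<not> y))"
      by (rule sum.cong[OF refl])
    also have "\<dots> = 2 + 1 / 2 * P y"
      using w[of y "\<not> y"] \<psi>[of y "\<not> y" "r (False, False)"] \<psi>[of y "\<not> y" "r (False, True)"]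
        \<psi>[of y "\<not> y" "r (True, False)"] \<psi>[of y "\<not> y" "r (True, True)"]
      by (cases y) (simp_all add: sum_bool_pair input_bit_def UNIV_bool pd d_def dlin bit_sign_def P_def, argo+)
    finally show ?thesis .
  qed
  have charlie: "(\<Sum>x\<in>UNIV. \<Sum>b\<in>UNIV. prob_det s b (input_bit x z) x y z) =
2 + 1 / 2 * Q y z" for y z
    using w[of y z] \<psi>[of y z "r (False, False)"] \<psi>[of y z "r (False, True)"]
      \<psi>[of y z "r (True, False)"] \<psi>[of y z "r (True, True)"]
    by (cases z) (simp_all add: sum_bool_pair input_bit_def UNIV_bool pd d_def dlin bit_sign_def Q_def, argo+)
  have nd: "norm (d False + d True) \<le> 2" "norm (d False - d True) \<le> 2"
  proof -
    \<comment> \<open>Two of the four vectors cancel in each combination, leaving the states of two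
      complementary inputs.\<close>
    have "d False + d True = 2 *\<^sub>R (r (False, False) - r (True, True))"
      "d False - d True = 2 *\<^sub>R (r (False, True) - r (True, False))"
      by (simp_all add: d_def scaleR_2)
    moreover have "norm (r x - r x') \<le> 1" for x x'
      using norm_triangle_ineq4[of "r x" "r x'"] r(1)[of x] r(1)[of x'] by linarith
    ultimately show "norm (d False + d True) \<le> 2" "norm (d False - d True) \<le> 2"
      by simp_all
  qed
  have "det_success \<alpha> s =
    \<alpha> / 8 * (\<Sum>y\<in>UNIV. \<Sum>x\<in>UNIV. \<Sum>c\<in>UNIV. prob_det s (input_bit x y) c x y False) +
    (1 - \<alpha>) / 16 * (\<Sum>z\<in>UNIV. \<Sum>y\<in>UNIV. \<Sum>x\<in>UNIV. \<Sum>b\<in>UNIV. prob_det s b (input_bit x z) x y z)"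
    by (simp add: det_success_def UNIV_bool sum.distrib field_simps flip: sum_divide_distrib)
  \<comment> \<open>Bob's prefactor is \<open>\<alpha> / 16\<close> and Charlie's is
    \<open>(1 - \<alpha>) / 32\<close>, as Charlie's success is averaged over \<open>y\<close>. The
    common factor 1/32 leaves Bob with weight \<open>2 * \<alpha>\<close>.\<close>
  also have "\<dots> = 1 / 2 + 1 / 32 * (\<Sum>y\<in>UNIV. \<Sum>b\<in>UNIV. \<Sum>c\<in>UNIV.
      2 * \<alpha> * bit_sign b * ?\<psi> y (\<not> y) b c (d y) +
      (1 - \<alpha>) * bit_sign c * ?\<psi> y (\<not> y) b c (d (\<not> y)) +
      (1 - \<alpha>) * bit_sign c * ?\<psi> y y b c (d y))"
  proof -
    have "(\<Sum>b\<in>UNIV. \<Sum>c\<in>UNIV. 2 * \<alpha> * bit_sign b * ?\<psi> y (\<not> y) b c (d y) +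
      (1 - \<alpha>) * bit_sign c * ?\<psi> y (\<not> y) b c (d (\<not> y)) +
      (1 - \<alpha>) * bit_sign c * ?\<psi> y y b c (d y)) =
      2 * \<alpha> * P y + (1 - \<alpha>) * Q y (\<not> y) + (1 - \<alpha>) * Q y y" for y
      by (simp only: P_def Q_def sum.distrib sum_distrib_left mult.assoc)
    then show ?thesis
      by (simp only: bob charlie)
        (simp add: UNIV_bool add_divide_distrib diff_divide_distrib algebra_simps)
  qed
  also have "\<dots> \<le> 1 / 2 + 1 / 32 * (4 * sqrt 2 * ((1 - \<alpha>) + sqrt ((2 * \<alpha>)\<^sup>2 + (1 - \<alpha>)\<^sup>2)))"
    using bob_charlie_bound[OF valid, of "2 * \<alpha>" "1 - \<alpha>" d] assms(1,2) nd
    by (intro add_left_mono mult_left_mono) simp_all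
  also have "\<dots> = 1 / 2 + (1 - \<alpha>) / (4 * sqrt 2) + 1 / (4 * sqrt 2) * sqrt ((1 - \<alpha>)\<^sup>2 + 4 * \<alpha>\<^sup>2)"
  proof -
    have inv: "x / (4 * sqrt 2) = sqrt 2 * x / 8" for x :: real
    proof -
      have "x * 8 = (sqrt 2 * x) * (4 * sqrt 2)"
        using real_sqrt_mult_self[of 2] by (simp del: real_sqrt_mult_self)
      then show ?thesis by (subst frac_eq_eq) auto
    qed
    have "1 / 2 + 1 / 32 * (4 * sqrt 2 * (q + R)) = 1 / 2 + q / (4 * sqrt 2) + 1 / (4 * sqrt 2) * R"
      for q R :: real
      by (simp only: inv times_divide_eq_left mult_1_left) (simp add: algebra_simps)
    moreover have "(2 * \<alpha>)\<^sup>2 + (1 - \<alpha>)\<^sup>2 = (1 - \<alpha>)\<^sup>2 + 4 * \<alpha>\<^sup>2"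
      by (simp add: power_mult_distrib)
    ultimately show ?thesis by (simp only:)
  qed
  finally show ?thesis .
qed

section \<open>Averaging over the shared randomness\<close>

theorem proposition2:
  fixes \<alpha> :: real and M :: "'w measure" and S :: "'w \<Rightarrow> strategy"
  assumes "0 \<le> \<alpha>" and "\<alpha> \<le> 1"
    and "shared_strategy M S"
  shows "success_prob \<alpha> M S \<le>
    1 / 2 + (1 - \<alpha>) / (4 * sqrt 2) + 1 / (4 * sqrt 2) * sqrt ((1 - \<alpha>)\<^sup>2 + 4 * \<alpha>\<^sup>2)"
    (is "_ \<le> ?B")
proof -
  interpret prob_space M using assms(3) by (simp add: shared_strategy_def)
  have "integrable M (\<lambda>\<omega>. det_success \<alpha> (S \<omega>))"
    unfolding det_success_def by (simp add: prob_det_integrable[OF assms(3)])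
  moreover have "det_success \<alpha> (S \<omega>) \<le> ?B" if "\<omega> \<in> space M" for \<omega>
    using assms that by (intro det_success_le) (auto simp: shared_strategy_def)
  ultimately show ?thesis
    unfolding success_prob_eq_integral[OF assms(3)]
    by (intro integral_le_const AE_I2)
qed

end
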